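(* There is an absolute constant $c>0$ such that for every $n\ge 1$ and every unbounded fan-in Boolean circuit $C$ of depth $3$ computing the parity function on $n$ variables, $\mathsf{EC}(C)\ge c\,n$; that is, $\mathsf{EC}(C)=\Omega(n)$.
   Context: An unbounded fan-in Boolean circuit is a directed acyclic graph with a root node of out-degree zero, input gates (in-degree zero) labeled by variables $x_1,\dots,x_n$, and non-input gates (including the root) that are AND or OR gates of arbitrary fan-in or NOT gates. The depth is the length of the longest path from the root to an input gate, where NOT gates may appear anywhere and do not count toward the depth (only AND and OR gates form levels). For $a\in\{0,1\}^n$, $\mathsf{EC}(C,a)$ is the number of non-input gates of $C$ (including NOT gates) that output $1$ on $a$, and $\mathsf{EC}(C)=\max_{a\in\{0,1\}^n}\mathsf{EC}(C,a)$. The parity function is $x\mapsto x_1\oplus\cdots\oplus x_n$. *)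

theory Defs
  imports Complex_Main
begin

text \<open>A wire \<open>(u, v)\<close> leads from \<open>u\<close> into \<open>v\<close>. The label \<open>Input i\<close> is the variable
  \<open>x_{i+1}\<close>, whose value under the assignment \<open>a\<close> is \<open>a ! i\<close>.\<close>

datatype gate = Input nat | And_gate | Or_gate | Not_gate

record 'v circuit =
  nodes :: "'v set"
  wires :: "('v \<times> 'v) set"
  root_node :: 'v
  label :: "'v \<Rightarrow> gate"

definition preds :: "'v circuit \<Rightarrow> 'v \<Rightarrow> 'v set" where
  "preds C v = {u. (u, v) \<in> wires C}"

definition is_input :: "'v circuit \<Rightarrow> 'v \<Rightarrow> bool" where
  "is_input C v \<longleftrightarrow> (\<exists>i. label C v = Input i)"

text \<open>The input gates are exactly the nodes of in-degree zero, so there are no empty conjunctions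
  or disjunctions. Distinct input gates may carry the same variable, and the root need not be the
  only sink.\<close>

definition is_circuit :: "nat \<Rightarrow> 'v circuit \<Rightarrow> bool" where
  "is_circuit n C \<longleftrightarrow>
     finite (nodes C) \<and> wires C \<subseteq> nodes C \<times> nodes C \<and> acyclic (wires C) \<and>
     root_node C \<in> nodes C \<and> \<not> is_input C (root_node C) \<and> (\<forall>v. (root_node C, v) \<notin> wires C) \<and>
     (\<forall>v \<in> nodes C. case label C v of
         Input i \<Rightarrow> i < n \<and> preds C v = {}
       | And_gate \<Rightarrow> preds C v \<noteq> {}
       | Or_gate \<Rightarrow> preds C v \<noteq> {}
       | Not_gate \<Rightarrow> card (preds C v) = 1)"

text \<open>Evaluation by recursion along the wires; the intended equation is \<open>gate_value_eq\<close> below.\<close>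

definition gate_step :: "'v circuit \<Rightarrow> bool list \<Rightarrow> ('v \<Rightarrow> bool) \<Rightarrow> 'v \<Rightarrow> bool" where
  "gate_step C a f v = (case label C v of
       Input i \<Rightarrow> a ! i
     | And_gate \<Rightarrow> (\<forall>u \<in> preds C v. f u)
     | Or_gate \<Rightarrow> (\<exists>u \<in> preds C v. f u)
     | Not_gate \<Rightarrow> \<not> f (the_elem (preds C v)))"

definition gate_value :: "'v circuit \<Rightarrow> bool list \<Rightarrow> 'v \<Rightarrow> bool" where
  "gate_value C a = wfrec (wires C) (gate_step C a)"

lemma wf_wires:
  assumes "is_circuit n C"
  shows "wf (wires C)"
proof -
  have "finite (wires C)"
    using assms finite_subset[of "wires C" "nodes C \<times> nodes C"] by (auto simp: is_circuit_def)
  then show ?thesis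
    using assms by (auto simp: is_circuit_def intro: finite_acyclic_wf)
qed

lemma gate_value_eq:
  assumes C: "is_circuit n C" and v: "v \<in> nodes C"
  shows "gate_value C a v = (case label C v of
       Input i \<Rightarrow> a ! i
     | And_gate \<Rightarrow> (\<forall>u \<in> preds C v. gate_value C a u)
     | Or_gate \<Rightarrow> (\<exists>u \<in> preds C v. gate_value C a u)
     | Not_gate \<Rightarrow> \<not> gate_value C a (the_elem (preds C v)))"
proof -
  have cut: "cut (gate_value C a) (wires C) v u = gate_value C a u" if "u \<in> preds C v" for u
    using that by (simp add: cut_def preds_def)
  have single: "the_elem (preds C v) \<in> preds C v" if "label C v = Not_gate"
  proof -
    have "card (preds C v) = 1"
      using C v that unfolding is_circuit_def by force
    then show ?thesis
      by (metis card_1_singletonE insertI1 the_elem_eq)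
  qed
  have "gate_value C a v = gate_step C a (cut (gate_value C a) (wires C) v) v"
    unfolding gate_value_def by (rule wfrec[OF wf_wires[OF C]])
  also have "\<dots> = gate_step C a (gate_value C a) v"
    using cut single by (simp add: gate_step_def split: gate.split)
  finally show ?thesis
    by (simp add: gate_step_def)
qed

definition input_paths :: "'v circuit \<Rightarrow> 'v list set" where
  "input_paths C = {p. p \<noteq> [] \<and> hd p = root_node C \<and> is_input C (last p) \<and>
     successively (\<lambda>v u. (u, v) \<in> wires C) p}"

text \<open>NOT gates do not contribute to the length of a path. On a path without NOT gates the
  number of AND and OR gates, the root included, is the number of edges.\<close>

definition depth :: "'v circuit \<Rightarrow> nat" where
  "depth C = Max ((\<lambda>p. length (filter (\<lambda>v. label C v \<in> {And_gate, Or_gate}) p)) ` input_paths C)"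

lemma finite_input_paths:
  assumes C: "is_circuit n C"
  shows "finite (input_paths C)"
proof -
  have fin: "finite (nodes C)" and sub: "wires C \<subseteq> nodes C \<times> nodes C" and root: "root_node C \<in> nodes C"
    using C by (auto simp: is_circuit_def)
  have acyc: "(v, v) \<notin> (wires C)\<^sup>+" for v
    using C by (auto simp: is_circuit_def acyclic_def)
  have path: "set p \<subseteq> nodes C \<and> distinct p \<and> (\<forall>u \<in> set (tl p). (u, hd p) \<in> (wires C)\<^sup>+)"
    if "p \<noteq> []" "hd p \<in> nodes C" "successively (\<lambda>v u. (u, v) \<in> wires C) p" for p
    using that
  proof (induction p)
    case (Cons v p)
    show ?case
    proof (cases p)
      case (Cons u q)
      then have uv: "(u, v) \<in> wires C" and "u \<in> nodes C"
        using Cons.prems sub by auto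
      then have IH: "set p \<subseteq> nodes C" "distinct p" "\<forall>w \<in> set q. (w, u) \<in> (wires C)\<^sup>+"
        using Cons.IH Cons.prems Cons by auto
      have below: "(w, v) \<in> (wires C)\<^sup>+" if "w \<in> set p" for w
        using that IH(3) uv Cons by (auto intro: trancl_into_trancl)
      then have "v \<notin> set p"
        using acyc by blast
      with below IH show ?thesis
        using Cons.prems by auto
    qed (use Cons.prems in auto)
  qed simp
  have "input_paths C \<subseteq> {p. set p \<subseteq> nodes C \<and> length p \<le> card (nodes C)}"
  proof
    fix p
    assume "p \<in> input_paths C"
    then have "set p \<subseteq> nodes C" "distinct p"
      using path[of p] root by (auto simp: input_paths_def)
    then show "p \<in> {p. set p \<subseteq> nodes C \<and> length p \<le> card (nodes C)}"
      using fin by (simp add: card_mono flip: distinct_card)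
  qed
  then show ?thesis
    using finite_lists_length_le[OF fin] by (rule finite_subset)
qed

definition EC_at :: "'v circuit \<Rightarrow> bool list \<Rightarrow> nat" where
  "EC_at C a = card {v \<in> nodes C. \<not> is_input C v \<and> gate_value C a v}"

definition EC :: "nat \<Rightarrow> 'v circuit \<Rightarrow> nat" where
  "EC n C = Max (EC_at C ` {a. length a = n})"

definition computes :: "nat \<Rightarrow> 'v circuit \<Rightarrow> (bool list \<Rightarrow> bool) \<Rightarrow> bool" where
  "computes n C f \<longleftrightarrow> (\<forall>a. length a = n \<longrightarrow> gate_value C a (root_node C) = f a)"

text \<open>On \<open>bool\<close>, exclusive or is \<open>\<noteq>\<close>.\<close>

definition parity :: "bool list \<Rightarrow> bool" where
  "parity a = foldr (\<noteq>) a False"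

end

theory Submission
  imports Defs "HOL-Analysis.Abstract_Topology_2"
begin

text \<open>Evaluate a depth-3 circuit at the all-zero input and let \<open>S\<close> be the set of those NOT gates,
  above inputs or above bottom-level AND/OR gates, that fire there. Fixing one variable per gate of
  \<open>S\<close> makes every gate of \<open>S\<close> constant; then every NOT gate of level at most one is constant, so
  gates of level at most one are monotone on the remaining subcube, gates of level at most two are
  monotone or antimonotone, and the root changes its value at most twice along any chain. Parity
  changes at every step of a chain, so at most two variables are free, i.e. \<open>n - 2 \<le> card S\<close>.\<close>

section \<open>Levels of gates and path lengths\<close>

text \<open>An upper bound on the number of AND and OR gates on paths down to inputs, given
  structurally. Rule induction then passes through chains of NOT gates at unchanged
  \<open>k\<close>.\<close>

inductive level_le :: "'v circuit \<Rightarrow> nat \<Rightarrow> 'v \<Rightarrow> bool" for C where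
  Input: "label C v = Input i \<Longrightarrow> level_le C k v"
| Not: "label C v = Not_gate \<Longrightarrow> (\<And>u. u \<in> preds C v \<Longrightarrow> level_le C k u) \<Longrightarrow> level_le C k v"
| And_Or: "label C v \<in> {And_gate, Or_gate} \<Longrightarrow> (\<And>u. u \<in> preds C v \<Longrightarrow> level_le C k u) \<Longrightarrow>
    level_le C (Suc k) v"

lemma level_le_mono:
  assumes "level_le C k v" "k \<le> m"
  shows "level_le C m v"
  using assms
proof (induction arbitrary: m rule: level_le.induct)
  case (And_Or v k)
  then obtain m' where "m = Suc m'" "k \<le> m'"
    by (cases m) auto
  with And_Or show ?case
    by (auto intro: level_le.And_Or)
qed (auto intro: level_le.intros)

text \<open>Generalizes \<open>input_paths\<close> to any start node, which induction along the
  wires requires.\<close>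

definition paths_from :: "'v circuit \<Rightarrow> 'v \<Rightarrow> 'v list set" where
  "paths_from C v = {p. p \<noteq> [] \<and> hd p = v \<and> is_input C (last p) \<and>
     successively (\<lambda>v u. (u, v) \<in> wires C) p}"

definition and_or_count :: "'v circuit \<Rightarrow> 'v list \<Rightarrow> nat" where
  "and_or_count C p = length (filter (\<lambda>v. label C v \<in> {And_gate, Or_gate}) p)"

lemma Cons_paths_from:
  assumes "u \<in> preds C v" "p \<in> paths_from C u"
  shows "v # p \<in> paths_from C v"
  using assms by (cases p) (auto simp: paths_from_def preds_def)

definition cube :: "nat set \<Rightarrow> (nat \<Rightarrow> bool) \<Rightarrow> (nat \<Rightarrow> bool) set" where
  "cube F b = {x. \<forall>i\<in>F. x i = b i}"

section \<open>Evaluation, and levels bounded by depth\<close>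

locale boolean_circuit =
  fixes n :: nat and C :: "'v circuit"
  assumes circuit: "is_circuit n C"
begin

text \<open>Assignments become functions, so that they can be updated at single variables and
  compared pointwise; only the values below \<open>n\<close> matter.\<close>

definition val :: "(nat \<Rightarrow> bool) \<Rightarrow> 'v \<Rightarrow> bool" where
  "val x v = gate_value C (map x [0..<n]) v"

lemma pred_in_nodes: "u \<in> preds C v \<Longrightarrow> u \<in> nodes C"
  using circuit by (auto simp: is_circuit_def preds_def)

lemma preds_nonempty:
  assumes "v \<in> nodes C" "\<not> is_input C v"
  shows "preds C v \<noteq> {}"
  using assms circuit
  by (cases "label C v") (force simp: is_circuit_def is_input_def)+

lemma Not_gate_pred:
  assumes "v \<in> nodes C" "label C v = Not_gate"
  obtains u where "preds C v = {u}"
proof -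
  have "card (preds C v) = 1"
    using circuit assms unfolding is_circuit_def by force
  then show thesis
    using that by (meson card_1_singletonE)
qed

lemma val_Input:
  assumes "v \<in> nodes C" "label C v = Input i"
  shows "i < n" "val x v = x i"
proof -
  show "i < n"
    using circuit assms unfolding is_circuit_def by force
  then show "val x v = x i"
    using gate_value_eq[OF circuit assms(1)] assms(2) by (simp add: val_def)
qed

lemma val_Not:
  assumes "v \<in> nodes C" "label C v = Not_gate" "preds C v = {u}"
  shows "val x v = (\<not> val x u)"
  using gate_value_eq[OF circuit assms(1)] assms(2,3) by (simp add: val_def)

lemma val_And:
  assumes "v \<in> nodes C" "label C v = And_gate"
  shows "val x v = (\<forall>u\<in>preds C v. val x u)"
  using gate_value_eq[OF circuit assms(1)] assms(2) by (simp add: val_def)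

lemma val_Or:
  assumes "v \<in> nodes C" "label C v = Or_gate"
  shows "val x v = (\<exists>u\<in>preds C v. val x u)"
  using gate_value_eq[OF circuit assms(1)] assms(2) by (simp add: val_def)

lemma paths_from_nonempty:
  assumes "v \<in> nodes C"
  shows "paths_from C v \<noteq> {}"
  using wf_wires[OF circuit] assms
proof (induction v rule: wf_induct_rule)
  case (less v)
  show ?case
  proof (cases "is_input C v")
    case True
    then have "[v] \<in> paths_from C v"
      by (simp add: paths_from_def)
    then show ?thesis by blast
  next
    case False
    then obtain u where u: "u \<in> preds C v"
      using preds_nonempty less.prems by blast
    then have "paths_from C u \<noteq> {}"
      using less.IH pred_in_nodes by (auto simp: preds_def)
    then show ?thesis
      using Cons_paths_from[OF u] by blast
  qed
qed

text \<open>Prepending \<open>v\<close> to a path from a predecessor raises the count by one exactly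
  when \<open>v\<close> is an AND or OR gate, which matches the rules of
  \<open>level_le\<close>.\<close>

lemma level_leI:
  assumes "v \<in> nodes C" "\<And>p. p \<in> paths_from C v \<Longrightarrow> and_or_count C p \<le> k"
  shows "level_le C k v"
  using wf_wires[OF circuit] assms
proof (induction v arbitrary: k rule: wf_induct_rule)
  case (less v)
  have step: "level_le C m u"
    if u: "u \<in> preds C v"
      and m: "\<And>p. p \<in> paths_from C u \<Longrightarrow> and_or_count C (v # p) \<le> k \<Longrightarrow> and_or_count C p \<le> m" for u m
    using less.IH[of u m] u m pred_in_nodes[OF u] less.prems(2) Cons_paths_from[OF u]
    by (auto simp: preds_def)
  consider (Input) i where "label C v = Input i" | (Not) "label C v = Not_gate"
    | (And_Or) "label C v \<in> {And_gate, Or_gate}"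
    by (cases "label C v") auto
  then show ?case
  proof cases
    case Input
    then show ?thesis by (rule level_le.Input)
  next
    case Not
    have "level_le C k u" if "u \<in> preds C v" for u
      using that by (rule step) (use Not in \<open>simp add: and_or_count_def\<close>)
    then show ?thesis
      using Not by (simp add: level_le.Not)
  next
    case And_Or
    obtain p where p: "p \<in> paths_from C v"
      using paths_from_nonempty less.prems(1) by blast
    \<comment> \<open>Some path exists and already counts \<open>v\<close>, so \<open>k\<close> is a
      successor, as the rule \<open>And_Or\<close> demands.\<close>
    then have "0 < and_or_count C p"
      using And_Or by (cases p) (auto simp: and_or_count_def paths_from_def)
    then obtain m where m: "k = Suc m"
      using less.prems(2)[OF p] by (cases k) auto
    have "level_le C m u" if "u \<in> preds C v" for u
      using that by (rule step) (use And_Or m in \<open>auto simp: and_or_count_def\<close>)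
    then show ?thesis
      using And_Or m by (simp add: level_le.And_Or)
  qed
qed

lemma level_le_depth: "level_le C (depth C) (root_node C)"
proof (rule level_leI)
  show "root_node C \<in> nodes C"
    using circuit by (simp add: is_circuit_def)
  fix p
  assume "p \<in> paths_from C (root_node C)"
  then show "and_or_count C p \<le> depth C"
    unfolding depth_def and_or_count_def
    by (intro Max_ge finite_imageI finite_input_paths[OF circuit] imageI)
      (simp add: paths_from_def input_paths_def)
qed

section \<open>Restrictions that make gates of level at most one constant\<close>

definition literal :: "'v \<Rightarrow> nat \<Rightarrow> bool \<Rightarrow> bool" where
  "literal v i s \<longleftrightarrow> (\<forall>x. val x v = (x i = s))"

text \<open>Only NOT gates can lie between such a gate and an input, and each of them flips the sign
  \<open>s\<close>.\<close>

lemma level_0_literal: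
  assumes "level_le C 0 v" "v \<in> nodes C"
  shows "\<exists>i s. literal v i s"
  using assms
proof (induction "0 :: nat" v rule: level_le.induct)
  case (Input v i)
  then have "literal v i True"
    using val_Input(2) by (simp add: literal_def)
  then show ?case by blast
next
  case (Not v)
  obtain u where u: "preds C v = {u}"
    using Not_gate_pred Not by blast
  then obtain i s where "literal u i s"
    using Not.hyps(3)[of u] pred_in_nodes[of u v] by auto
  then have "literal v i (\<not> s)"
    using val_Not[OF Not.prems Not.hyps(1) u] by (auto simp: literal_def)
  then show ?case by blast
qed

text \<open>Up to NOT gates, \<open>v\<close> is an input or an AND or OR of literals. One literal
  on a free variable, set to the absorbing value, decides an AND or OR; if no such literal is left,
  the gate is already constant.\<close>

lemma fix_level_1:
  assumes "level_le C 1 v" "v \<in> nodes C" "finite F"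
  shows "\<exists>F' b'. finite F' \<and> card F' \<le> Suc (card F) \<and> cube F' b' \<subseteq> cube F b \<and>
    (\<lambda>x. val x v) constant_on cube F' b'"
  using assms(1,2)
proof (induction "1 :: nat" v rule: level_le.induct)
  case (Input v i)
  show ?case
  proof (cases "i \<in> F")
    case True
    then show ?thesis
      using Input val_Input(2)[of v i] assms(3)
      by (intro exI[of _ F] exI[of _ b]) (auto simp: cube_def constant_on_def)
  next
    case False
    then show ?thesis
      using Input val_Input(2)[of v i] assms(3)
      by (intro exI[of _ "insert i F"] exI[of _ "b(i := True)"])
        (auto simp: cube_def constant_on_def card_insert_if)
  qed
next
  case (Not v)
  obtain u where u: "preds C v = {u}"
    using Not_gate_pred Not by blast
  then obtain F' b' where "finite F'" "card F' \<le> Suc (card F)" "cube F' b' \<subseteq> cube F b"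
      "(\<lambda>x. val x u) constant_on cube F' b'"
    using Not.hyps(3)[of u] pred_in_nodes[of u v] by auto
  then show ?case
    using val_Not[OF Not.prems Not.hyps(1) u]
    by (intro exI[of _ F'] exI[of _ b']) (auto simp: constant_on_def)
next
  case (And_Or v k)
  have lit: "\<exists>i s. literal u i s" if "u \<in> preds C v" for u
  proof (rule level_0_literal)
    show "level_le C 0 u"
      using And_Or.hyps(2)[OF that] And_Or.hyps(4) by simp
  qed (rule pred_in_nodes[OF that])
  show ?case
  proof (cases "\<exists>u\<in>preds C v. \<exists>i s. i \<notin> F \<and> literal u i s")
    case True
    then obtain u i s where u: "u \<in> preds C v" "i \<notin> F" "literal u i s"
      by blast
    \<comment> \<open>The truth value of \<open>label C v = Or_gate\<close> is the absorbing value
      of the gate: True for OR, False for AND. The new value of \<open>i\<close> makes the literal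
      \<open>u\<close> equal to it.\<close>
    define b' where "b' = b(i := (s = (label C v = Or_gate)))"
    have "val x v = (label C v = Or_gate)" if "x \<in> cube (insert i F) b'" for x
    proof -
      have "val x u = (label C v = Or_gate)"
        using that u(3) by (auto simp: cube_def b'_def literal_def)
      then show ?thesis
        using And_Or.hyps(1) u(1) val_And[OF And_Or.prems] val_Or[OF And_Or.prems] by auto
    qed
    moreover have "cube (insert i F) b' \<subseteq> cube F b"
      using u(2) by (auto simp: cube_def b'_def)
    moreover have "card (insert i F) \<le> Suc (card F)"
      using assms(3) by (simp add: card_insert_if)
    ultimately show ?thesis
      using assms(3)
      by (intro exI[of _ "insert i F"] exI[of _ b']) (auto simp: constant_on_def)
  next
    case False
    \<comment> \<open>The point \<open>b\<close> lies in \<open>cube F b\<close> and serves as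
      reference for constancy.\<close>
    have "val x u = val b u" if x: "x \<in> cube F b" and u: "u \<in> preds C v" for x u
    proof -
      obtain i s where "literal u i s" "i \<in> F"
        using lit[OF u] u False by blast
      then show ?thesis
        using x by (simp add: cube_def literal_def)
    qed
    then have "\<forall>x\<in>cube F b. val x v = val b v"
      using And_Or.hyps(1) val_And[OF And_Or.prems] val_Or[OF And_Or.prems] by auto
    then show ?thesis
      using assms(3)
      by (intro exI[of _ F] exI[of _ b]) (auto simp: constant_on_def)
  qed
qed

text \<open>Gates are treated one after another at a cost of at most one variable each; constancy
  survives passing to a smaller cube.\<close>

lemma fix_level_1_gates:
  assumes "finite T" "\<And>v. v \<in> T \<Longrightarrow> level_le C 1 v \<and> v \<in> nodes C" "finite F"
  shows "\<exists>F' b'. finite F' \<and> card F' \<le> card F + card T \<and> cube F' b' \<subseteq> cube F b \<and>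
    (\<forall>v\<in>T. (\<lambda>x. val x v) constant_on cube F' b')"
  using assms(1,2)
proof (induction T)
  case empty
  then show ?case
    using assms(3) by auto
next
  case (insert v T)
  then obtain F1 b1 where 1: "finite F1" "card F1 \<le> card F + card T" "cube F1 b1 \<subseteq> cube F b"
      "\<forall>v\<in>T. (\<lambda>x. val x v) constant_on cube F1 b1"
    by auto
  obtain F2 b2 where 2: "finite F2" "card F2 \<le> Suc (card F1)" "cube F2 b2 \<subseteq> cube F1 b1"
      "(\<lambda>x. val x v) constant_on cube F2 b2"
    using fix_level_1[of v F1 b1] insert.prems 1(1) by auto
  have "\<forall>w\<in>insert v T. (\<lambda>x. val x w) constant_on cube F2 b2"
    using 1(4) 2(3,4) by (auto intro: constant_on_subset)
  moreover have "card F2 \<le> card F + card (insert v T)"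
    using 1(2) 2(2) insert.hyps by simp
  ultimately show ?case
    using 1(3) 2(1,3) by (intro exI[of _ F2] exI[of _ b2]) auto
qed

section \<open>NOT gates that fire at the all-zero input\<close>

text \<open>The set \<open>S\<close> of the overview is \<open>fired_Nots 1\<close>; it contains
  \<open>fired_Nots 0\<close>.\<close>

definition fired_Nots :: "nat \<Rightarrow> 'v set" where
  "fired_Nots k = {v \<in> nodes C. label C v = Not_gate \<and> level_le C k v \<and> val (\<lambda>_. False) v}"

lemma fired_Nots_0_subset: "fired_Nots 0 \<subseteq> fired_Nots 1"
  by (auto simp: fired_Nots_def intro: level_le_mono)

lemma finite_nodes: "finite (nodes C)"
  using circuit by (simp add: is_circuit_def)

lemma finite_fired_Nots: "finite (fired_Nots k)"
  using finite_nodes by (simp add: fired_Nots_def)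

text \<open>The level-0 gates must become constantly true, not just constant: an OR gate that is true at
  zero because of such a gate has to stay true.\<close>

lemma fix_fired_Nots:
  "\<exists>F b. finite F \<and> card F \<le> card (fired_Nots 1) \<and>
    (\<forall>v\<in>fired_Nots 0. \<forall>x\<in>cube F b. val x v) \<and>
    (\<forall>v\<in>fired_Nots 1. (\<lambda>x. val x v) constant_on cube F b)"
proof -
  \<comment> \<open>A literal that is true at the all-zero input is a negated variable, so fixing
    that variable to False keeps it true.\<close>
  have "\<forall>v\<in>fired_Nots 0. \<exists>i. \<forall>x. val x v = (\<not> x i)"
  proof
    fix v
    assume v: "v \<in> fired_Nots 0"
    then obtain i s where lit: "literal v i s"
      using level_0_literal[of v] by (auto simp: fired_Nots_def)
    moreover have "val (\<lambda>_. False) v"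
      using v by (simp add: fired_Nots_def)
    ultimately have "\<forall>x. val x v = (\<not> x i)"
      by (simp add: literal_def)
    then show "\<exists>i. \<forall>x. val x v = (\<not> x i)" ..
  qed
  then obtain w where w: "\<And>v x. v \<in> fired_Nots 0 \<Longrightarrow> val x v = (\<not> x (w v))"
    by metis
  let ?I = "w ` fired_Nots 0"
  let ?T = "fired_Nots 1 - fired_Nots 0"
  \<comment> \<open>The variables in \<open>?I\<close> are set to False first; the remaining fired
    gates are then fixed inside that subcube.\<close>
  have "\<exists>F b. finite F \<and> card F \<le> card ?I + card ?T \<and> cube F b \<subseteq> cube ?I (\<lambda>_. False) \<and>
      (\<forall>v\<in>?T. (\<lambda>x. val x v) constant_on cube F b)"
    by (rule fix_level_1_gates) (simp_all add: finite_fired_Nots, simp add: fired_Nots_def)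
  then obtain F b where F: "finite F" "card F \<le> card ?I + card ?T"
      "cube F b \<subseteq> cube ?I (\<lambda>_. False)" "\<forall>v\<in>?T. (\<lambda>x. val x v) constant_on cube F b"
    by (elim exE conjE)
  have true: "\<forall>v\<in>fired_Nots 0. \<forall>x\<in>cube F b. val x v"
  proof (intro ballI)
    fix v x
    assume v: "v \<in> fired_Nots 0" and "x \<in> cube F b"
    then have "x \<in> cube ?I (\<lambda>_. False)"
      using F(3) by blast
    then show "val x v"
      using v w[OF v] by (simp add: cube_def)
  qed
  \<comment> \<open>Several gates may negate the same variable, so \<open>w\<close> need not be
    injective.\<close>
  have "card ?I + card ?T \<le> card (fired_Nots 0) + card ?T"
    by (simp add: card_image_le finite_fired_Nots)
  also have "\<dots> = card (fired_Nots 1)"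
    using fired_Nots_0_subset finite_fired_Nots
    by (simp add: card_Diff_subset card_mono)
  finally have "card F \<le> card (fired_Nots 1)"
    using F(2) by simp
  moreover have "(\<lambda>x. val x v) constant_on cube F b" if "v \<in> fired_Nots 0" for v
    using true that by (auto simp: constant_on_def)
  then have "\<forall>v\<in>fired_Nots 1. (\<lambda>x. val x v) constant_on cube F b"
    using F(4) by blast
  ultimately show ?thesis
    using F(1) true by blast
qed

section \<open>Monotonicity on a set \<open>R\<close> where the fired NOT gates are fixed\<close>

context
  fixes R :: "(nat \<Rightarrow> bool) set"
  assumes true_0: "\<And>v x. v \<in> fired_Nots 0 \<Longrightarrow> x \<in> R \<Longrightarrow> val x v"
    and const_1: "\<And>v. v \<in> fired_Nots 1 \<Longrightarrow> (\<lambda>x. val x v) constant_on R"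
begin

text \<open>Inputs are false at the all-zero input, so only a fired NOT gate remains.\<close>

lemma level_0_true:
  assumes "level_le C 0 v" "v \<in> nodes C" "val (\<lambda>_. False) v" "x \<in> R"
  shows "val x v"
  using assms(1)
proof cases
  case (Input i)
  then show ?thesis
    using assms val_Input by simp
next
  case Not
  then have "v \<in> fired_Nots 0"
    using assms(1-3) by (simp add: fired_Nots_def)
  then show ?thesis
    using true_0 assms(4) by blast
qed

text \<open>A fired NOT gate is constant by assumption. An AND or OR gate owes its truth at zero to
  level-0 predecessors that are true there; these stay true on \<open>R\<close>, hence so does the
  gate.\<close>

lemma level_1_const:
  assumes "level_le C 1 v" "v \<in> nodes C" "val (\<lambda>_. False) v"
  shows "(\<lambda>x. val x v) constant_on R"
  using assms(1)
proof cases
  case (Input i)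
  then show ?thesis
    using assms val_Input(2) by simp
next
  case Not
  then have "v \<in> fired_Nots 1"
    using assms by (simp add: fired_Nots_def)
  then show ?thesis by (rule const_1)
next
  case (And_Or k)
  have level_0: "level_le C 0 u" if "u \<in> preds C v" for u
    using And_Or(1) And_Or(3)[OF that] by simp
  have keep: "val x u" if "u \<in> preds C v" "val (\<lambda>_. False) u" "x \<in> R" for x u
    using level_0_true[OF level_0 pred_in_nodes] that by blast
  have "\<forall>x\<in>R. val x v"
  proof (cases "label C v = And_gate")
    case True
    show ?thesis
      using assms(3) keep unfolding val_And[OF assms(2) True] by blast
  next
    case False
    then have Or: "label C v = Or_gate"
      using And_Or(2) by simp
    show ?thesis
      using assms(3) keep unfolding val_Or[OF assms(2) Or] by blast
  qed
  then show ?thesis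
    by (auto simp: constant_on_def)
qed

text \<open>At the all-zero input either the gate or its predecessor is true, and
  \<open>level_1_const\<close> applies to whichever it is.\<close>

lemma level_1_Not_const:
  assumes "level_le C 1 v" "v \<in> nodes C" "label C v = Not_gate"
  shows "(\<lambda>x. val x v) constant_on R"
proof (cases "val (\<lambda>_. False) v")
  case True
  then show ?thesis
    using level_1_const assms by simp
next
  case False
  obtain u where u: "preds C v = {u}"
    using Not_gate_pred assms by blast
  have "level_le C 1 u"
    using assms(1) by cases (use assms(3) u in auto)
  then have "(\<lambda>x. val x u) constant_on R"
    using False val_Not[OF assms(2,3) u] pred_in_nodes[of u v] u by (intro level_1_const) auto
  then show ?thesis
    using val_Not[OF assms(2,3) u] by (auto simp: constant_on_def)
qed

lemma mono_on_And_Or: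
  assumes "v \<in> nodes C" "label C v \<in> {And_gate, Or_gate}"
    and "\<And>u. u \<in> preds C v \<Longrightarrow> mono_on R (\<lambda>x. val x u)"
  shows "mono_on R (\<lambda>x. val x v)"
proof (rule mono_onI)
  fix x y
  assume "x \<in> R" "y \<in> R" "x \<le> y"
  then have le: "val x u \<Longrightarrow> val y u" if "u \<in> preds C v" for u
    using assms(3)[OF that] by (auto simp: mono_on_def)
  show "val x v \<le> val y v"
  proof (cases "label C v = And_gate")
    case True
    show ?thesis
      using le unfolding val_And[OF assms(1) True] le_bool_def by blast
  next
    case False
    then have Or: "label C v = Or_gate"
      using assms(2) by simp
    show ?thesis
      using le unfolding val_Or[OF assms(1) Or] le_bool_def by blast
  qed
qed

lemma mono_on_Input:
  assumes "v \<in> nodes C" "label C v = Input i"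
  shows "mono_on R (\<lambda>x. val x v)"
  using val_Input(2)[OF assms] by (auto simp: mono_on_def le_fun_def)

text \<open>NOT gates are constant here, and AND and OR preserve monotonicity. The bound
  \<open>k \<le> 1\<close> instead of \<open>k = 1\<close> lets the induction descend to level
  0.\<close>

lemma level_1_mono:
  assumes "level_le C k v" "k \<le> 1" "v \<in> nodes C"
  shows "mono_on R (\<lambda>x. val x v)"
  using assms
proof (induction rule: level_le.induct)
  case (Input v i k)
  then show ?case using mono_on_Input by blast
next
  case (Not v k)
  then have "level_le C 1 v"
    by (meson level_le.Not level_le_mono)
  then show ?case
    using level_1_Not_const[of v] Not.hyps(1) Not.prems(2)
    by (auto simp: constant_on_def monotone_on_def)
next
  case (And_Or v k)
  have "mono_on R (\<lambda>x. val x u)" if "u \<in> preds C v" for u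
    by (rule And_Or.IH[OF that _ pred_in_nodes[OF that]]) (use And_Or.prems(1) in simp)
  then show ?case
    by (rule mono_on_And_Or[OF And_Or.prems(2) And_Or.hyps(1)])
qed

text \<open>AND and OR gates have predecessors of level at most one and are monotone; NOT gates on
  top of them only swap the two alternatives.\<close>

lemma level_2_monotone:
  assumes "level_le C 2 v" "v \<in> nodes C"
  shows "mono_on R (\<lambda>x. val x v) \<or> antimono_on R (\<lambda>x. val x v)"
  using assms
proof (induction "2 :: nat" v rule: level_le.induct)
  case (Input v i)
  then show ?case using mono_on_Input by blast
next
  case (Not v)
  obtain u where u: "preds C v = {u}"
    using Not_gate_pred Not by blast
  then have "mono_on R (\<lambda>x. val x u) \<or> antimono_on R (\<lambda>x. val x u)"
    using Not.hyps(3)[of u] pred_in_nodes[of u v] by auto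
  then show ?case
    using val_Not[OF Not.prems Not.hyps(1) u] by (auto simp: monotone_on_def)
next
  case (And_Or v k)
  have "k \<le> 1"
    using And_Or.hyps(4) by simp
  then have "mono_on R (\<lambda>x. val x u)" if "u \<in> preds C v" for u
    using level_1_mono[OF And_Or.hyps(2)[OF that]] pred_in_nodes[OF that] by simp
  then have "mono_on R (\<lambda>x. val x v)"
    by (rule mono_on_And_Or[OF And_Or.prems And_Or.hyps(1)])
  then show ?case ..
qed

text \<open>An AND of monotone and antimonotone functions is true on a convex set, an OR is false on a
  convex set; an alternating chain of four points violates both.\<close>

lemma level_3_no_alternation:
  assumes "level_le C 3 v" "v \<in> nodes C"
    and R: "x1 \<in> R" "x2 \<in> R" "x3 \<in> R" "x4 \<in> R" and le: "x1 \<le> x2" "x2 \<le> x3" "x3 \<le> x4"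
  shows "\<not> (val x1 v \<noteq> val x2 v \<and> val x2 v \<noteq> val x3 v \<and> val x3 v \<noteq> val x4 v)"
  using assms(1,2)
proof (induction "3 :: nat" v rule: level_le.induct)
  case (Input v i)
  then show ?case
    using le val_Input(2)[of v i] by (auto simp: le_fun_def)
next
  case (Not v)
  obtain u where u: "preds C v = {u}"
    using Not_gate_pred Not by blast
  then show ?case
    using val_Not[OF Not.prems Not.hyps(1) u] Not.hyps(3)[of u] pred_in_nodes[of u v] by auto
next
  case (And_Or v k)
  have k: "k = 2"
    using And_Or.hyps(4) by simp
  have unate: "mono_on R (\<lambda>x. val x u) \<or> antimono_on R (\<lambda>x. val x u)" if "u \<in> preds C v" for u
    using And_Or.hyps(2)[OF that] k pred_in_nodes[OF that] level_2_monotone by blast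
  \<comment> \<open>A monotone or antimonotone function with equal values at the ends of a chain
    keeps that value in between. Convexity below uses this with \<open>c\<close> True for AND and
    False for OR.\<close>
  have between: "val y u = c"
    if "u \<in> preds C v" "val x u = c" "val z u = c" "x \<le> y" "y \<le> z" "x \<in> R" "y \<in> R" "z \<in> R" for u x y z c
    using unate[OF that(1)] that(2-) by (auto simp: monotone_on_def)
  show ?case
  proof (cases "label C v = And_gate")
    case True
    have convex: "val y v" if "val x v" "val z v" "x \<le> y" "y \<le> z" "x \<in> R" "y \<in> R" "z \<in> R" for x y z
      using that between unfolding val_And[OF And_Or.prems True] by blast
    then show ?thesis
      using R le by metis
  next
    case False
    then have Or: "label C v = Or_gate"
      using And_Or.hyps(1) by auto
    have convex: "\<not> val y v" if "\<not> val x v" "\<not> val z v" "x \<le> y" "y \<le> z" "x \<in> R" "y \<in> R" "z \<in> R" for x y z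
      using that between unfolding val_Or[OF And_Or.prems Or] by blast
    then show ?thesis
      using R le by metis
  qed
qed

end

section \<open>Bounding the number of fired NOT gates by \<open>EC\<close>\<close>

lemma EC_at_le_EC: "length a = n \<Longrightarrow> EC_at C a \<le> EC n C"
  unfolding EC_def
  using finite_lists_length_eq[of "UNIV :: bool set" n] by (intro Max_ge) auto

lemma card_fired_Nots_le: "card (fired_Nots k) \<le> EC n C"
proof -
  have "card (fired_Nots k) \<le> EC_at C (map (\<lambda>_. False) [0..<n])"
    unfolding EC_at_def fired_Nots_def val_def
    using finite_nodes by (intro card_mono) (auto simp: is_input_def)
  also have "\<dots> \<le> EC n C"
    by (rule EC_at_le_EC) simp
  finally show ?thesis .
qed

end

section \<open>Parity along chains and the final bound\<close>

lemma parity_flip: "i < length a \<Longrightarrow> parity (a[i := \<not> a ! i]) = (\<not> parity a)"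
proof (induction a arbitrary: i)
  case (Cons b a)
  then show ?case
    by (cases i) (auto simp: parity_def)
qed simp

lemma parity_map_set:
  assumes "i < n" "\<not> x i"
  shows "parity (map (x(i := True)) [0..<n]) = (\<not> parity (map x [0..<n]))"
proof -
  have "map (x(i := True)) [0..<n] = (map x [0..<n])[i := \<not> map x [0..<n] ! i]"
    using assms by (intro nth_equalityI) (auto simp: nth_list_update)
  then show ?thesis
    using assms parity_flip[of i "map x [0..<n]"] by simp
qed

text \<open>Otherwise three variables stay free in the cube, and raising them one by one gives a
  chain of four points on which parity alternates, contradicting
  \<open>level_3_no_alternation\<close>.\<close>

lemma parity_depth_3_EC:
  assumes "is_circuit n C" "depth C = 3" "computes n C parity"
  shows "n \<le> EC n C + 2"
proof (rule ccontr)
  interpret boolean_circuit n C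
    by unfold_locales (fact assms)
  assume "\<not> n \<le> EC n C + 2"
  moreover obtain F b where F: "finite F" "card F \<le> card (fired_Nots 1)"
      "\<forall>v\<in>fired_Nots 0. \<forall>x\<in>cube F b. val x v"
      "\<forall>v\<in>fired_Nots 1. (\<lambda>x. val x v) constant_on cube F b"
    using fix_fired_Nots by auto
  moreover have "card {..<n} - card F \<le> card ({..<n} - F)"
    using F(1) by (rule diff_card_le_card_Diff)
  ultimately have "3 \<le> card ({..<n} - F)"
    using card_fired_Nots_le[of 1] by simp
  then obtain T where "T \<subseteq> {..<n} - F" "card T = 3"
    by (meson obtain_subset_with_card_n)
  then obtain i j k where free: "{i, j, k} \<subseteq> {..<n} - F" "i \<noteq> j" "j \<noteq> k" "i \<noteq> k"
    by (auto simp: card_3_iff)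
  \<comment> \<open>The least point of \<open>cube F b\<close>: it agrees with \<open>b\<close> on
    \<open>F\<close> and is False elsewhere, so the free variables can be raised without leaving the
    cube.\<close>
  define x1 where "x1 = (\<lambda>m. m \<in> F \<and> b m)"
  define x2 where "x2 = x1(i := True)"
  define x3 where "x3 = x2(j := True)"
  define x4 where "x4 = x3(k := True)"
  note defs = x1_def x2_def x3_def x4_def
  have R: "x1 \<in> cube F b" "x2 \<in> cube F b" "x3 \<in> cube F b" "x4 \<in> cube F b"
    using free by (auto simp: cube_def defs)
  have le: "x1 \<le> x2" "x2 \<le> x3" "x3 \<le> x4"
    by (auto simp: defs le_fun_def)
  have root: "val x (root_node C) = parity (map x [0..<n])" for x
    using assms(3) by (simp add: val_def computes_def)
  have "val x2 (root_node C) \<noteq> val x1 (root_node C)"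
    using free by (simp add: root x2_def parity_map_set x1_def)
  moreover have "val x3 (root_node C) \<noteq> val x2 (root_node C)"
  proof -
    have "\<not> x2 j" using free by (auto simp: x1_def x2_def)
    then show ?thesis using free by (simp add: root x3_def parity_map_set)
  qed
  moreover have "val x4 (root_node C) \<noteq> val x3 (root_node C)"
  proof -
    have "\<not> x3 k" using free by (auto simp: x1_def x2_def x3_def)
    then show ?thesis using free by (simp add: root x4_def parity_map_set)
  qed
  moreover have "root_node C \<in> nodes C" "level_le C 3 (root_node C)"
    using assms level_le_depth by (auto simp: is_circuit_def)
  ultimately show False
    using level_3_no_alternation[OF _ _ _ _ R le] F(3,4) by blast
qed

text \<open>Parity is true somewhere, and there the root itself is a non-input gate with output 1.
  This serves to absorb the additive 2 of \<open>parity_depth_3_EC\<close>.\<close>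

lemma parity_EC_pos:
  assumes "is_circuit n C" "computes n C parity" "1 \<le> n"
  shows "1 \<le> EC n C"
proof -
  interpret boolean_circuit n C
    by unfold_locales (fact assms)
  have root: "root_node C \<in> nodes C" "\<not> is_input C (root_node C)"
    using circuit by (auto simp: is_circuit_def)
  obtain a where a: "length a = n" "parity a"
    using parity_flip[of 0 "replicate n False"] assms(3)
    by (metis length_list_update length_replicate less_eq_Suc_le One_nat_def)
  then have "gate_value C a (root_node C)"
    using assms(2) by (simp add: computes_def)
  then have "1 \<le> EC_at C a"
    using root finite_nodes by (auto simp: EC_at_def Suc_le_eq card_gt_0_iff)
  then show ?thesis
    using EC_at_le_EC[OF a(1)] by linarith
qed

theorem theorem1p4:
  "\<exists>c::real. c > 0 \<and>
     (\<forall>n \<ge> 1. \<forall>C :: nat circuit.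
        is_circuit n C \<and> depth C = 3 \<and> computes n C parity \<longrightarrow> real (EC n C) \<ge> c * real n)"
proof (intro exI[of _ "1/3"] conjI allI impI)
  fix n :: nat and C :: "nat circuit"
  assume "1 \<le> n" "is_circuit n C \<and> depth C = 3 \<and> computes n C parity"
  then have "n \<le> EC n C + 2" "1 \<le> EC n C"
    using parity_depth_3_EC[of n C] parity_EC_pos[of n C] by auto
  \<comment> \<open>The constant comes from
    \<open>n \<le> EC n C + 2 \<le> 3 * EC n C\<close>.\<close>
  then show "1 / 3 * real n \<le> real (EC n C)"
    by linarith
qed simp

end
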